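(* Let $X$ be a metric space containing a homeomorphic (not necessarily isometric) image of $\mathbb{R}^2$. Then there exists a value $b(X) > 0$ such that any continuous function $f : X \to \mathbb{R}$ has a contour $C$ with $$\operatorname{diam}(C) \ge b(X).$$
   Context: A contour of $f : X \to \mathbb{R}$ is a connected component of a level set $f^{-1}(y)$ for some $y \in \mathbb{R}$. The value $b(X)$ depends only on $X$, not on $f$. *)

theory Defs
  imports "HOL-Analysis.Analysis"
begin

definition is_contour :: "'a::topological_space set \<Rightarrow> ('a \<Rightarrow> real) \<Rightarrow> 'a set \<Rightarrow> bool" where
  "is_contour X f C \<longleftrightarrow> (\<exists>y. C \<in> components {x \<in> X. f x = y})"

text \<open>The diameter with values in \<open>[0, \<infinity>]\<close>. The library constant \<^const>\<open>diameter\<close> is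
  real-valued and carries no information on unbounded sets, but contours may be unbounded.\<close>

definition ediam :: "'a::metric_space set \<Rightarrow> ennreal" where
  "ediam S = (SUP (x, y) \<in> S \<times> S. ennreal (dist x y))"

end

theory Submission
  imports Defs
begin

text \<open>If every contour of \<open>f\<close> were small, the disc could be covered by finitely many closed sets of
  small diameter, no three of which meet: cut it into slabs between consecutive levels of \<open>f\<close>, so
  thin that each slab is a disjoint union of small pieces. Taking a triangle for the disc and
  ``missing a side'' for ``small'', this contradicts the Lebesgue covering theorem, a consequence of
  Brouwer's fixed point theorem. Hence some contour inside the triangle touches all three sides, and
  \<open>b\<close> is obtained from the fact that the three sides have no common point.\<close>

section \<open>The standard simplex and the Lebesgue covering theorem\<close>

definition std_simplex :: "(real^'n) set" where
  "std_simplex = {x. (\<forall>i. 0 \<le> x$i) \<and> (\<Sum>i\<in>UNIV. x$i) = 1}"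

text \<open>This is the facet opposite the vertex \<open>axis i 1\<close>.\<close>

definition std_facet :: "'n \<Rightarrow> (real^'n) set" where
  "std_facet i = {x \<in> std_simplex. x$i = 0}"

lemma compact_std_simplex: "compact (std_simplex :: (real^'n) set)"
proof -
  have "closed {x::real^'n. \<forall>i. 0 \<le> x$i}" "closed {x::real^'n. (\<Sum>i\<in>UNIV. x$i) = 1}"
    by (intro closed_Collect_all closed_Collect_le closed_Collect_eq continuous_intros)+
  then have "closed (std_simplex :: (real^'n) set)"
    unfolding std_simplex_def Collect_conj_eq by (rule closed_Int)
  moreover have "norm x \<le> 1" if "x \<in> std_simplex" for x :: "real^'n"
    using norm_le_l1_cart[of x] that by (simp add: std_simplex_def)
  then have "bounded (std_simplex :: (real^'n) set)"
    by (auto simp: bounded_iff)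
  ultimately show ?thesis
    by (simp add: compact_eq_bounded_closed)
qed

lemma convex_std_simplex: "convex (std_simplex :: (real^'n) set)"
  by (auto simp: convex_def std_simplex_def sum.distrib simp flip: sum_distrib_left)

lemma axis_in_std_simplex: "axis i 1 \<in> std_simplex"
  by (simp add: std_simplex_def axis_def)

lemma axis_in_std_facet: "i \<noteq> j \<Longrightarrow> axis i 1 \<in> std_facet j"
  using axis_in_std_simplex[of i] by (simp add: std_facet_def axis_def)

lemma compact_std_facet: "compact (std_facet (i::'n) :: (real^'n) set)"
proof -
  have "closed {x::real^'n. x$i = 0}"
    by (intro closed_Collect_eq continuous_intros)
  moreover have "std_facet i = std_simplex \<inter> {x. x$i = 0}"
    by (auto simp: std_facet_def)
  ultimately show ?thesis
    by (simp add: compact_std_simplex compact_Int_closed)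
qed

text \<open>Without a common point, the distances to the sets \<open>A i\<close>, divided by their
  sum, are the coordinates of a continuous self-map of the simplex. By Brouwer it fixes some
  \<open>x\<close>. If \<open>x\<close> lies in \<open>A k\<close>, its \<open>k\<close>-th
  coordinate vanishes, which puts it on the very facet that \<open>A k\<close> misses.\<close>

lemma Lebesgue_covering_std_simplex:
  fixes A :: "'n \<Rightarrow> (real^'n) set"
  assumes clo: "\<And>i. closed (A i)"
    and cover: "std_simplex \<subseteq> (\<Union>i. A i)"
    and miss: "\<And>i. A i \<inter> std_facet i = {}"
  shows "\<exists>x\<in>std_simplex. \<forall>i. x \<in> A i"
proof (rule ccontr)
  assume none: "\<not> ?thesis"
  \<comment> \<open>The vertex \<open>axis i 1\<close> lies on every facet but the
    \<open>i\<close>-th, so only \<open>A i\<close> can contain it. Nonemptiness matters because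
    \<open>infdist\<close> to the empty set is 0 by convention.\<close>
  have ne: "A i \<noteq> {}" for i
  proof -
    obtain j where "axis i 1 \<in> A j"
      using cover axis_in_std_simplex[of i] by blast
    then show ?thesis
      using miss[of j] axis_in_std_facet[of i j] by blast
  qed
  define s where "s x = (\<Sum>j\<in>UNIV. infdist x (A j))" for x
  define F where "F x = (\<chi> i. infdist x (A i) / s x)" for x
  have pos: "s x > 0" if "x \<in> std_simplex" for x
  proof -
    have "\<not> (\<forall>i. x \<in> A i)" using none that by (auto simp only: bex_simps)
    then obtain i where "x \<notin> A i" by auto
    then have "infdist x (A i) > 0"
      by (rule infdist_pos_not_in_closed[OF clo ne])
    then show ?thesis
      unfolding s_def by (intro sum_pos2[of _ i]) (auto simp: infdist_nonneg)
  qed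
  have "continuous_on std_simplex F"
    unfolding F_def s_def
    using pos[unfolded s_def]
    by (intro continuous_on_vec_lambda continuous_intros) (auto simp: less_le)
  moreover have "F x \<in> std_simplex" if "x \<in> std_simplex" for x
    using pos[OF that]
    by (auto simp: std_simplex_def F_def infdist_nonneg s_def simp flip: sum_divide_distrib)
  ultimately obtain x where x: "x \<in> std_simplex" "F x = x"
    using brouwer[OF compact_std_simplex convex_std_simplex, of F] axis_in_std_simplex by blast
  then obtain k where k: "x \<in> A k" using cover by blast
  then have "F x $ k = 0" by (simp add: F_def)
  then have "x \<in> std_facet k" using x by (simp add: std_facet_def)
  then show False using k miss by blast
qed

section \<open>Splitting compact sets into separated pieces\<close>

text \<open>The index of an open set names the set it avoids, so one \<open>U i\<close> may gather
  many separated pieces. The family thus stays indexed by \<open>'n\<close> however many pieces are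
  needed.\<close>

definition splits_avoiding :: "('n \<Rightarrow> 'a::topological_space set) \<Rightarrow> 'a set \<Rightarrow> bool" where
  "splits_avoiding E K \<longleftrightarrow> (\<exists>U. (\<forall>i. open (U i) \<and> U i \<inter> E i = {}) \<and>
     (\<forall>i j. i \<noteq> j \<longrightarrow> U i \<inter> U j = {}) \<and> K \<subseteq> (\<Union>i. U i))"

lemma splits_avoiding_subset:
  "splits_avoiding E K \<Longrightarrow> L \<subseteq> K \<Longrightarrow> splits_avoiding E L"
  unfolding splits_avoiding_def by (elim exE, rule_tac x = U in exI) auto

lemma splits_avoiding_single:
  assumes "closed (E k)" "K \<inter> E k = {}"
  shows "splits_avoiding E K"
  unfolding splits_avoiding_def
  using assms by (intro exI[of _ "\<lambda>i. if i = k then - E k else {}"]) auto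

text \<open>Disjoint closed sets have disjoint open neighbourhoods. After restriction to these, the
  two families can be merged index by index without creating overlaps.\<close>

lemma splits_avoiding_Un:
  fixes K L :: "'a::euclidean_space set"
  assumes "splits_avoiding E K" "splits_avoiding E L" "closed K" "closed L" "K \<inter> L = {}"
  shows "splits_avoiding E (K \<union> L)"
proof -
  obtain V W where VW: "open V" "open W" "K \<subseteq> V" "L \<subseteq> W" "V \<inter> W = {}"
    using separation_normal assms by metis
  obtain U where U: "\<And>i. open (U i)" "\<And>i. U i \<inter> E i = {}"
      "\<And>i j. i \<noteq> j \<Longrightarrow> U i \<inter> U j = {}" "K \<subseteq> (\<Union>i. U i)"
    using assms(1) unfolding splits_avoiding_def by metis
  obtain U' where U': "\<And>i. open (U' i)" "\<And>i. U' i \<inter> E i = {}"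
      "\<And>i j. i \<noteq> j \<Longrightarrow> U' i \<inter> U' j = {}" "L \<subseteq> (\<Union>i. U' i)"
    using assms(2) unfolding splits_avoiding_def by metis
  define T where "T i = U i \<inter> V \<union> U' i \<inter> W" for i
  have "open (T i)" "T i \<inter> E i = {}" for i
    using U(1,2)[of i] U'(1,2)[of i] VW(1,2) by (auto simp: T_def)
  moreover have "T i \<inter> T j = {}" if "i \<noteq> j" for i j
    using U(3)[OF that] U'(3)[OF that] VW(5) by (auto simp: T_def)
  moreover have "K \<union> L \<subseteq> (\<Union>i. T i)"
    using U(4) U'(4) VW(3,4) by (fastforce simp: T_def)
  ultimately show ?thesis
    unfolding splits_avoiding_def by (intro exI[of _ T]) simp
qed

text \<open>By the Sura-Bura theorem, a component missing \<open>E i\<close> lies in a relatively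
  clopen piece that still misses \<open>E i\<close>. Finitely many such pieces cover
  \<open>K\<close>, and subtracting each new piece from the earlier ones makes them
  disjoint.\<close>

lemma splits_avoiding_components:
  fixes K :: "'a::euclidean_space set"
  assumes K: "compact K" and E: "\<And>i. closed (E i)"
    and comps: "\<And>C. C \<in> components K \<Longrightarrow> \<exists>i. C \<inter> E i = {}"
  shows "splits_avoiding E K"
proof -
  have "\<exists>V. open V \<and> x \<in> V \<and> compact (K \<inter> V) \<and> splits_avoiding E (K \<inter> V)" if "x \<in> K" for x
  proof -
    define C where "C = connected_component_set K x"
    have C: "C \<in> components K" "x \<in> C"
      using that by (auto simp: C_def componentsI)
    then obtain i where i: "C \<inter> E i = {}" using comps by blast
    obtain Q where Q: "openin (top_of_set K) Q" "compact Q" "C \<subseteq> Q" "Q \<subseteq> - E i"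
      using Sura_Bura_clopen_subset[of K C "- E i"] K C i E[of i]
      by (metis closed_imp_locally_compact compact_components compact_imp_closed disjoint_eq_subset_Compl
          open_Compl)
    obtain V where "open V" "Q = K \<inter> V" using Q(1) by (auto simp: openin_open)
    moreover have "splits_avoiding E Q"
      using Q(4) by (intro splits_avoiding_single[of E i] E) auto
    ultimately show ?thesis using Q C by blast
  qed
  then obtain V where V: "\<And>x. x \<in> K \<Longrightarrow> open (V x)" "\<And>x. x \<in> K \<Longrightarrow> x \<in> V x"
      "\<And>x. x \<in> K \<Longrightarrow> compact (K \<inter> V x)" "\<And>x. x \<in> K \<Longrightarrow> splits_avoiding E (K \<inter> V x)"
    by metis
  obtain F where F: "F \<subseteq> K" "finite F" "K \<subseteq> (\<Union>x\<in>F. V x)"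
    by (rule compactE_image[OF K, of K V]) (use V in auto)
  have "compact (K \<inter> (\<Union>x\<in>F. V x)) \<and> splits_avoiding E (K \<inter> (\<Union>x\<in>F. V x))"
    using F(2,1)
  proof (induction F)
    case empty
    show ?case by (auto simp: splits_avoiding_def)
  next
    case (insert x F)
    let ?W = "\<Union>x\<in>F. V x"
    have x: "x \<in> K" and IH: "compact (K \<inter> ?W)" "splits_avoiding E (K \<inter> ?W)"
      using insert by auto
    \<comment> \<open>Since \<open>V x\<close> is open and \<open>K \<inter> V x\<close> is compact,
      both parts are compact, as merging their splittings requires.\<close>
    have eq: "K \<inter> (\<Union>x\<in>insert x F. V x) = (K \<inter> ?W - V x) \<union> (K \<inter> V x)"
      by blast
    have "compact (K \<inter> ?W - V x)"
      using IH(1) V(1)[OF x] by (rule compact_diff)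
    moreover have "splits_avoiding E (K \<inter> ?W - V x)"
      using IH(2) by (rule splits_avoiding_subset) blast
    ultimately show ?case
      unfolding eq using V(3,4)[OF x]
      by (auto intro!: splits_avoiding_Un compact_Un compact_imp_closed)
  qed
  moreover have "K \<inter> (\<Union>x\<in>F. V x) = K" using F by blast
  ultimately show ?thesis by simp
qed

section \<open>Covers of order two and a level component touching all sides\<close>

text \<open>The slabs are glued along common levels. In \<open>Q\<close> a point on an extreme level lies in one
  set only, so that a point on a common level lies in at most two.\<close>

lemma order_two_cover:
  fixes D :: "'a::euclidean_space set" and g :: "'a \<Rightarrow> real"
  assumes D: "compact D" and g: "continuous_on D g" and E: "\<And>i. closed (E i)"
    and comps: "\<And>y C. C \<in> components {x \<in> D. g x = y} \<Longrightarrow> \<exists>i. C \<inter> E i = {}"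
  obtains A :: "'n \<Rightarrow> 'a set" where "\<And>i. closed (A i)" "\<And>i. A i \<inter> E i = {}" "D \<subseteq> (\<Union>i. A i)"
    "\<And>x i j k. x \<in> A i \<Longrightarrow> x \<in> A j \<Longrightarrow> x \<in> A k \<Longrightarrow> i = j \<or> i = k \<or> j = k"
proof (cases "D = {}")
  case True
  then show ?thesis by (intro that[of "\<lambda>_. {}"]) auto
next
  case False
  have slab: "compact {x \<in> D. g x \<in> S}" if "closed S" for S
  proof -
    have "closed (D \<inter> g -` S)"
      using continuous_closed_preimage[OF g compact_imp_closed[OF D] that] .
    then have "compact (D \<inter> (D \<inter> g -` S))" using D by (rule compact_Int_closed[rotated])
    moreover have "D \<inter> (D \<inter> g -` S) = {x \<in> D. g x \<in> S}" by auto
    ultimately show ?thesis by simp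
  qed
  define Q where "Q a b A \<longleftrightarrow>
      (\<forall>i. closed (A i) \<and> A i \<inter> E i = {} \<and> A i \<subseteq> {x \<in> D. g x \<in> {a..b}}) \<and>
      {x \<in> D. g x \<in> {a..b}} \<subseteq> (\<Union>i. A i) \<and>
      (\<forall>x i j k. x \<in> A i \<longrightarrow> x \<in> A j \<longrightarrow> x \<in> A k \<longrightarrow> i = j \<or> i = k \<or> j = k) \<and>
      (\<forall>x i j. x \<in> A i \<longrightarrow> x \<in> A j \<longrightarrow> g x = a \<or> g x = b \<longrightarrow> i = j)"
    for a b and A :: "'n \<Rightarrow> 'a set"
  have Q: "closed (A i)" "A i \<inter> E i = {}" "A i \<subseteq> {x \<in> D. g x \<in> {a..b}}"
      "{x \<in> D. g x \<in> {a..b}} \<subseteq> (\<Union>i. A i)"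
      "x \<in> A i \<Longrightarrow> x \<in> A j \<Longrightarrow> x \<in> A k \<Longrightarrow> i = j \<or> i = k \<or> j = k"
      "x \<in> A i \<Longrightarrow> x \<in> A j \<Longrightarrow> g x = a \<or> g x = b \<Longrightarrow> i = j"
    if "Q a b A" for a b A x i j k
    using that by (simp_all only: Q_def)
  obtain m M where mM: "m \<in> D" "M \<in> D" "\<And>x. x \<in> D \<Longrightarrow> g m \<le> g x \<and> g x \<le> g M"
    using continuous_attains_inf[OF D False g] continuous_attains_sup[OF D False g] by blast
  then have "g m \<le> g M" by blast
  then have "\<exists>A. Q (g m) (g M) A"
  \<comment> \<open>Bisection reduces the claim to gluing two adjacent intervals and to short
    intervals around each level \<open>y\<close>.\<close>
  proof (induction rule: Bolzano)
    case (trans a b c)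
    consider "a = b" | "b = c" | "a < b" "b < c" using trans(3,4) by linarith
    then show ?case
    proof cases
      \<comment> \<open>In the degenerate cases one of the two given covers already serves. Here
        strictness keeps levels \<open>a\<close> and \<open>c\<close> away from \<open>b\<close>, so
        a point on an extreme level meets only one of the two families.\<close>
      case 3
      obtain A B where "Q a b A" "Q b c B" using trans(1,2) by blast
      note A = Q[OF this(1)] and B = Q[OF this(2)]
      define T where "T i = A i \<union> B i" for i
      have low: "x \<notin> B i" if "g x < b" for x i using B(3)[of i] that by auto
      have high: "x \<notin> A i" if "g x > b" for x i using A(3)[of i] that by auto
      have "closed (T i)" "T i \<inter> E i = {}" "T i \<subseteq> {x \<in> D. g x \<in> {a..c}}" for i
        using A(1-3)[of i] B(1-3)[of i] 3 by (auto simp: T_def)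
      moreover have "{x \<in> D. g x \<in> {a..c}} \<subseteq> (\<Union>i. T i)"
      proof
        fix x assume x: "x \<in> {x \<in> D. g x \<in> {a..c}}"
        then have "x \<in> {x \<in> D. g x \<in> {a..b}} \<or> x \<in> {x \<in> D. g x \<in> {b..c}}" by auto
        then show "x \<in> (\<Union>i. T i)" using A(4) B(4) unfolding T_def by blast
      qed
      moreover have "i = j \<or> i = k \<or> j = k" if "x \<in> T i" "x \<in> T j" "x \<in> T k" for x i j k
      proof (cases "g x" b rule: linorder_cases)
        case less
        then show ?thesis using that low A(5)[of x i j k] by (auto simp: T_def)
      next
        case equal
        \<comment> \<open>Level \<open>b\<close> is extreme for both slabs, so \<open>x\<close> has
          at most one index from \<open>A\<close> and one from \<open>B\<close>. Among three indices
          two must agree.\<close>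
        then have "p = q" if "x \<in> A p \<and> x \<in> A q \<or> x \<in> B p \<and> x \<in> B q" for p q
          using that A(6) B(6) by blast
        then show ?thesis using that unfolding T_def by blast
      next
        case greater
        then show ?thesis using that high B(5)[of x i j k] by (auto simp: T_def)
      qed
      moreover have "i = j" if "x \<in> T i" "x \<in> T j" "g x = a \<or> g x = c" for x i j
      proof (cases "g x = a")
        case True
        then have "x \<in> A i" "x \<in> A j" using that low 3 by (auto simp: T_def)
        then show ?thesis using A(6) True by blast
      next
        case False
        then have "g x = c" "x \<in> B i" "x \<in> B j" using that high 3 by (auto simp: T_def)
        then show ?thesis using B(6) by blast
      qed
      ultimately show ?thesis by (intro exI[of _ T]) (simp add: Q_def)
    qed (use trans in auto)
  next
    case (local y)
    have "compact {x \<in> D. g x = y}" using slab[of "{y}"] by simp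
    then have "splits_avoiding E {x \<in> D. g x = y}"
      using E comps by (rule splits_avoiding_components)
    then obtain U where U: "\<And>i. open (U i)" "\<And>i. U i \<inter> E i = {}"
      "\<And>i j. i \<noteq> j \<Longrightarrow> U i \<inter> U j = {}" "{x \<in> D. g x = y} \<subseteq> (\<Union>i. U i)"
      unfolding splits_avoiding_def by metis
    \<comment> \<open>The values taken outside the open sets form a compact set missing
      \<open>y\<close>. Its distance from \<open>y\<close> tells how thin a slab must be for the
      \<open>U i\<close> to cover it.\<close>
    have "compact (g ` (D - (\<Union>i. U i)))"
      using D U(1) by (intro compact_continuous_image compact_diff continuous_on_subset[OF g]) auto
    moreover have "y \<notin> g ` (D - (\<Union>i. U i))" using U(4) by blast
    ultimately obtain d where d: "d > 0" "ball y d \<subseteq> - g ` (D - (\<Union>i. U i))"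
      by (metis ComplI compact_imp_closed open_Compl open_contains_ball)
    have "\<exists>A. Q a b A" if ab: "a \<le> y" "y \<le> b" "b - a < d" for a b
    proof -
      let ?S = "{x \<in> D. g x \<in> {a..b}}"
      define A where "A i = ?S \<inter> U i" for i
      have SU: "?S \<subseteq> (\<Union>i. U i)"
      proof
        fix x assume x: "x \<in> ?S"
        then have "g x \<in> ball y d" using ab by (auto simp: dist_real_def)
        then show "x \<in> (\<Union>i. U i)" using d x by blast
      qed
      have "closed (A i)" for i
      proof -
        \<comment> \<open>As the \<open>U j\<close> are disjoint and cover the slab, cutting with
          \<open>U i\<close> amounts to removing the other open sets, which leaves a closed
          set.\<close>
        have "A i = ?S - (\<Union>j\<in>-{i}. U j)"
        proof (intro equalityI subsetI)
          fix x assume "x \<in> A i"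
          then have "x \<in> ?S" "x \<in> U i" by (simp_all add: A_def)
          moreover have "x \<notin> U j" if "i \<noteq> j" for j using U(3)[OF that] \<open>x \<in> U i\<close> by blast
          ultimately show "x \<in> ?S - (\<Union>j\<in>-{i}. U j)" by auto
        next
          fix x assume x: "x \<in> ?S - (\<Union>j\<in>-{i}. U j)"
          then obtain j where "x \<in> U j" using SU by auto
          then show "x \<in> A i" using x by (cases "i = j") (auto simp: A_def)
        qed
        moreover have "compact (?S - (\<Union>j\<in>-{i}. U j))"
          using U(1) by (intro compact_diff slab) auto
        ultimately show ?thesis using compact_imp_closed by metis
      qed
      moreover have "A i \<inter> E i = {}" "A i \<subseteq> ?S" for i using U(2)[of i] by (auto simp: A_def)
      moreover have "?S \<subseteq> (\<Union>i. A i)" using SU by (auto simp: A_def)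
      \<comment> \<open>The sets of a thin slab are pairwise disjoint, which gives both multiplicity
        conditions of \<open>Q\<close> at once.\<close>
      moreover have "i = j" if "x \<in> A i" "x \<in> A j" for x i j
        using U(3)[of i j] that by (auto simp: A_def)
      ultimately show ?thesis by (intro exI[of _ A]) (auto simp: Q_def)
    qed
    then show ?case using d by blast
  qed
  then obtain A where "Q (g m) (g M) A" ..
  note A = Q[OF this]
  have "D \<subseteq> (\<Union>i. A i)" using A(4) mM by auto
  then show ?thesis using A(1,2,5) by (intro that[of A])
qed

text \<open>Otherwise the triangle has a closed cover by three sets, each missing its own side, with
  no point in all three. This is what the Lebesgue covering theorem forbids.\<close>

lemma contour_meets_all_sides:
  fixes g :: "real^3 \<Rightarrow> real"
  assumes g: "continuous_on std_simplex g"
  obtains y C where "C \<in> components {x \<in> std_simplex. g x = y}" "\<And>i. C \<inter> std_facet i \<noteq> {}"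
proof (rule ccontr)
  assume "\<not> thesis"
  with that have comps: "\<exists>i. C \<inter> std_facet i = {}"
    if "C \<in> components {x \<in> std_simplex. g x = y}" for y C
    using that by metis
  have clo: "closed (std_facet i :: (real^3) set)" for i
    by (rule compact_imp_closed[OF compact_std_facet])
  obtain A :: "3 \<Rightarrow> (real^3) set" where A: "\<And>i. closed (A i)" "\<And>i. A i \<inter> std_facet i = {}"
      "std_simplex \<subseteq> (\<Union>i. A i)"
      "\<And>x i j k. x \<in> A i \<Longrightarrow> x \<in> A j \<Longrightarrow> x \<in> A k \<Longrightarrow> i = j \<or> i = k \<or> j = k"
    by (rule order_two_cover[OF compact_std_simplex g clo comps]) auto
  obtain x where "\<And>i. x \<in> A i"
    using Lebesgue_covering_std_simplex[OF A(1,3,2)] by blast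
  then show False using A(4)[of x 1 2 3] by simp
qed

section \<open>Transfer to the metric space and the choice of the bound\<close>

text \<open>The sum of the two distances attains its minimum on the compact product. A minimum of 0
  would give a common point, and one of the two summands is always at least half the
  minimum.\<close>

lemma compact_triple_separation:
  fixes A B C :: "'a::metric_space set"
  assumes "compact A" "compact B" "compact C" "A \<inter> B \<inter> C = {}"
  obtains b :: real where "b > 0"
    "\<And>x y z. x \<in> A \<Longrightarrow> y \<in> B \<Longrightarrow> z \<in> C \<Longrightarrow> b \<le> dist x y \<or> b \<le> dist x z"
proof (cases "A \<times> B \<times> C = {}")
  case True
  then show ?thesis using that[of 1] by auto
next
  case False
  define h where "h p = dist (fst p) (fst (snd p)) + dist (fst p) (snd (snd p))" for p :: "'a \<times> 'a \<times> 'a"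
  have "compact (A \<times> B \<times> C)" using assms by (intro compact_Times)
  moreover have "continuous_on (A \<times> B \<times> C) h"
    unfolding h_def by (intro continuous_intros)
  ultimately obtain p where p: "p \<in> A \<times> B \<times> C" "\<And>q. q \<in> A \<times> B \<times> C \<Longrightarrow> h p \<le> h q"
    using continuous_attains_inf False by metis
  have "h p \<noteq> 0"
    using p(1) assms(4) by (auto simp: h_def add_nonneg_eq_0_iff)
  then have "h p > 0" by (simp add: h_def less_le)
  moreover have "h p / 2 \<le> dist x y \<or> h p / 2 \<le> dist x z" if "x \<in> A" "y \<in> B" "z \<in> C" for x y z
    using p(2)[of "(x, y, z)"] that by (auto simp: h_def)
  ultimately show ?thesis using that[of "h p / 2"] by simp
qed

lemma dist_le_ediam: "x \<in> S \<Longrightarrow> y \<in> S \<Longrightarrow> ennreal (dist x y) \<le> ediam S"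
  unfolding ediam_def using SUP_upper[of "(x, y)" "S \<times> S" "\<lambda>(x, y). ennreal (dist x y)"] by simp

lemma std_simplex_embeds_in_plane:
  obtains e :: "real^3 \<Rightarrow> real^2" where "continuous_on UNIV e" "inj_on e std_simplex"
proof
  let ?e = "\<lambda>x::real^3. \<chi> i::2. if i = 1 then x$1 else x$2"
  show "continuous_on UNIV ?e"
  proof (rule continuous_on_vec_lambda)
    show "continuous_on UNIV (\<lambda>x::real^3. if i = 1 then x$1 else x$2)" for i :: 2
      by (cases "i = 1") (auto intro!: continuous_intros)
  qed
  show "inj_on ?e std_simplex"
  proof (rule inj_onI)
    fix x y :: "real^3"
    assume "x \<in> std_simplex" "y \<in> std_simplex" and eq: "?e x = ?e y"
    then have "x$1 + x$2 + x$3 = y$1 + y$2 + y$3" by (simp add: std_simplex_def sum_3)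
    moreover have "x$1 = y$1" "x$2 = y$2"
      using arg_cong[OF eq, of "\<lambda>v. v$1"] arg_cong[OF eq, of "\<lambda>v. v$2"] by auto
    ultimately show "x = y" by (simp add: vec_eq_iff forall_3)
  qed
qed

theorem proposition5p8:
  fixes X :: "'a::metric_space set"
  assumes "\<exists>S\<subseteq>X. S homeomorphic (UNIV :: (real^2) set)"
  shows "\<exists>b::real. b > 0 \<and>
    (\<forall>f :: 'a \<Rightarrow> real. continuous_on X f \<longrightarrow>
      (\<exists>C. is_contour X f C \<and> ediam C \<ge> ennreal b))"
proof -
  obtain S h k where S: "S \<subseteq> X" and "homeomorphism S (UNIV :: (real^2) set) k h"
    using assms unfolding homeomorphic_def by blast
  then have h: "continuous_on UNIV h" "range h = S" "inj h"
    by (auto simp: homeomorphism_def intro: inj_on_inverseI)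
  obtain e :: "real^3 \<Rightarrow> real^2" where e: "continuous_on UNIV e" "inj_on e std_simplex"
    using std_simplex_embeds_in_plane .
  define q where "q = h \<circ> e"
  have q: "continuous_on std_simplex q" "inj_on q std_simplex" "q ` std_simplex \<subseteq> X"
  proof -
    show "continuous_on std_simplex q"
      unfolding q_def using h(1) e(1) by (meson continuous_on_compose continuous_on_subset subset_UNIV)
    show "inj_on q std_simplex"
      unfolding q_def using h(3) e(2) by (meson comp_inj_on inj_on_subset subset_UNIV)
    show "q ` std_simplex \<subseteq> X" using h(2) S by (auto simp: q_def)
  qed
  let ?Q = "\<lambda>i. q ` std_facet i"
  have sub: "std_facet i \<subseteq> std_simplex" for i :: 3 by (auto simp: std_facet_def)
  have cpt: "compact (?Q i)" for i
    by (rule compact_continuous_image[OF continuous_on_subset[OF q(1) sub] compact_std_facet])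
  have "std_facet 1 \<inter> std_facet 2 \<inter> std_facet (3::3) = {}"
    by (auto simp: std_facet_def std_simplex_def sum_3)
  then have "?Q 1 \<inter> ?Q 2 \<inter> ?Q 3 = {}"
    using q(2) sub by (simp add: le_infI1 flip: inj_on_image_Int)
  \<comment> \<open>The bound comes from the embedded triangle alone and is fixed before
    \<open>f\<close> is introduced.\<close>
  then obtain b where b: "b > 0"
      "\<And>x y z. x \<in> ?Q 1 \<Longrightarrow> y \<in> ?Q 2 \<Longrightarrow> z \<in> ?Q 3 \<Longrightarrow> b \<le> dist x y \<or> b \<le> dist x z"
    using compact_triple_separation[OF cpt cpt cpt] by metis
  have "\<exists>C. is_contour X f C \<and> ediam C \<ge> ennreal b" if f: "continuous_on X f" for f :: "'a \<Rightarrow> real"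
  proof -
    have "continuous_on std_simplex (f \<circ> q)"
      using q f by (blast intro: continuous_on_compose continuous_on_subset)
    then obtain y K where K: "K \<in> components {x \<in> std_simplex. (f \<circ> q) x = y}"
        "\<And>i. K \<inter> std_facet i \<noteq> {}"
      using contour_meets_all_sides by metis
    have Ksub: "K \<subseteq> {x \<in> std_simplex. (f \<circ> q) x = y}" using K(1) by (rule in_components_subset)
    have "connected (q ` K)"
      using in_components_connected[OF K(1)] Ksub
      by (intro connected_continuous_image continuous_on_subset[OF q(1)]) auto
    moreover have qK: "q ` K \<subseteq> {x \<in> X. f x = y}" using Ksub q(3) by auto
    moreover have "q ` K \<noteq> {}" using K(2) by blast
    \<comment> \<open>The image of \<open>K\<close> is connected and lies in one level set of
      \<open>f\<close>, hence in one contour in \<open>X\<close>. That contour may be larger than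
      the image, but it still meets all three embedded sides.\<close>
    ultimately obtain C where C: "C \<in> components {x \<in> X. f x = y}" "q ` K \<subseteq> C"
      using exists_component_superset[of "q ` K"] by blast
    have meet: "\<exists>p. p \<in> ?Q i \<and> p \<in> C" for i using K(2)[of i] C(2) by blast
    obtain p1 p2 p3 where p: "p1 \<in> ?Q 1" "p2 \<in> ?Q 2" "p3 \<in> ?Q 3" "p1 \<in> C" "p2 \<in> C" "p3 \<in> C"
      using meet[of 1] meet[of 2] meet[of 3] by (elim exE conjE)
    have "b \<le> dist p1 p2 \<or> b \<le> dist p1 p3" using b(2)[OF p(1-3)] .
    then have "ennreal b \<le> ediam C"
      using dist_le_ediam[OF p(4,5)] dist_le_ediam[OF p(4,6)] by (meson ennreal_leI order_trans)
    then show ?thesis using C(1) unfolding is_contour_def by blast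
  qed
  then show ?thesis using b(1) by blast
qed

end
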